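(* Let $G$ be a (simple, undirected) graph of girth $g$ and minimum degree $\delta\ge 2$. 1. If $g\ge 7$, then $G$ admits a $(1,\le\delta)$-identifying code. 2. If $g\ge 5$, then $G$ admits a $(1,\le\delta-1)$-identifying code.
   Context: For a graph $G=(V,E)$ and vertex $u$, $N[u]$ is the closed neighbourhood ($u$ together with its neighbours), and $N[U]=\bigcup_{u\in U}N[u]$ for $U\subseteq V$. A set $C\subseteq V$ is a $(1,\le\ell)$-identifying code in $G$ if $N[X]\cap C\neq N[Y]\cap C$ for all distinct $X,Y\subseteq V$ with $1\le|X|,|Y|\le\ell$; $G$ admits such a code if some such $C$ exists. The girth is the length of a shortest cycle. *)

theory Defs
  imports "Graph_Theory.Graph_Theory" "HOL-Library.Extended_Nat"
begin

text \<open>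
  A simple undirected graph is a loop-free symmetric \<^typ>\<open>'a pair_pre_digraph\<close>, i.e.
  \<^const>\<open>pair_bidirected_digraph\<close>: each edge \<open>uv\<close> is the pair of arcs \<open>(u, v)\<close>, \<open>(v, u)\<close>.
  The vertex set may be infinite and vertices may have infinite degree; finite graphs are a
  special case.
\<close>

definition neighbourhood :: "'a pair_pre_digraph \<Rightarrow> 'a \<Rightarrow> 'a set" where
  "neighbourhood G u = {v. u \<rightarrow>\<^bsub>with_proj G\<^esub> v}"

definition closed_neighbourhood :: "'a pair_pre_digraph \<Rightarrow> 'a \<Rightarrow> 'a set" where
  "closed_neighbourhood G u = insert u (neighbourhood G u)"

definition closed_neighbourhood_set :: "'a pair_pre_digraph \<Rightarrow> 'a set \<Rightarrow> 'a set" where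
  "closed_neighbourhood_set G U = (\<Union>u\<in>U. closed_neighbourhood G u)"

text \<open>
  Degrees are extended naturals, because \<^const>\<open>out_degree\<close> (being a \<^const>\<open>card\<close>) is 0 at a
  vertex with infinitely many neighbours.
\<close>

definition degree :: "'a pair_pre_digraph \<Rightarrow> 'a \<Rightarrow> enat" where
  "degree G u = (if finite (neighbourhood G u) then enat (card (neighbourhood G u)) else \<infinity>)"

definition min_degree :: "'a pair_pre_digraph \<Rightarrow> enat" where
  "min_degree G = (INF u\<in>pverts G. degree G u)"

text \<open>
  The library notion \<^const>\<open>pre_digraph.cycle\<close> is the directed one, for which going back and
  forth along an edge is a cycle of length 2. In a loop-free symmetric digraph the cycles of length
  at least 3 are precisely the cycles of the undirected graph. The girth of an acyclic
  graph is \<open>\<infinity>\<close>.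
\<close>

definition undirected_cycle :: "'a pair_pre_digraph \<Rightarrow> ('a \<times> 'a) list \<Rightarrow> bool" where
  "undirected_cycle G p \<longleftrightarrow> pre_digraph.cycle (with_proj G) p \<and> 3 \<le> length p"

definition girth :: "'a pair_pre_digraph \<Rightarrow> enat" where
  "girth G = (INF p\<in>{p. undirected_cycle G p}. enat (length p))"

text \<open>The condition \<open>1 \<le> card X\<close> also forces \<open>X\<close> to be finite; likewise for \<open>Y\<close>.\<close>

definition identifying_code :: "'a pair_pre_digraph \<Rightarrow> nat \<Rightarrow> 'a set \<Rightarrow> bool" where
  "identifying_code G l C \<longleftrightarrow> C \<subseteq> pverts G \<and>
     (\<forall>X Y. X \<subseteq> pverts G \<and> Y \<subseteq> pverts G \<and> X \<noteq> Y \<and>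
        1 \<le> card X \<and> card X \<le> l \<and> 1 \<le> card Y \<and> card Y \<le> l \<longrightarrow>
        closed_neighbourhood_set G X \<inter> C \<noteq> closed_neighbourhood_set G Y \<inter> C)"

definition admits_identifying_code :: "'a pair_pre_digraph \<Rightarrow> nat \<Rightarrow> bool" where
  "admits_identifying_code G l \<longleftrightarrow> (\<exists>C. identifying_code G l C)"

end

theory Submission
  imports Defs
begin

text \<open>
  Suppose two distinct sets \<open>X\<close> and \<open>Y\<close> have the same closed neighbourhood, and let \<open>x\<close> lie in
  \<open>X\<close> but not in \<open>Y\<close>. All neighbours of \<open>x\<close> must be covered by \<open>Y\<close>. Without triangles and
  squares, a vertex other than \<open>x\<close> covers at most one neighbour of \<open>x\<close>; hence \<open>card Y\<close> is at
  least the degree of \<open>x\<close> (\<open>card_neighbourhood_le\<close>). This settles the bound for girth 5.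

  For girth 7 the sets may have size \<open>\<delta>\<close>, and the same count is tight: \<open>Y\<close> has exactly one element
  in the closed neighbourhood of each neighbour of \<open>x\<close>, and no other elements
  (\<open>perfect_cover\<close>); so in particular all of \<open>Y\<close> is within
  distance 2 of \<open>x\<close>. As \<open>Y\<close> is then at least as large as \<open>X\<close>, it also has an element outside
  \<open>X\<close>, and the same holds with \<open>X\<close> and \<open>Y\<close> exchanged. One first finds an edge \<open>xv\<close> with
  \<open>x\<close> only in \<open>X\<close> and \<open>v\<close> only in \<open>Y\<close> (\<open>neighbour_not_in_both\<close>). Take another neighbour \<open>w\<close>
  of \<open>v\<close>. An element of \<open>X\<close> covering \<open>w\<close> is at distance 2 or 3 from \<open>x\<close> by way of \<open>v\<close>,
  whereas the elements of \<open>Y\<close> other than \<open>v\<close> are reached from \<open>x\<close> through other neighbours; but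
  the former has to be close to one of the latter, and joining them closes a cycle of length
  at most 6 (\<open>no_adjacent_pair\<close>).
\<close>

section \<open>Short cycles\<close>

lemma girth_le_length: "undirected_cycle G p \<Longrightarrow> girth G \<le> enat (length p)"
  unfolding girth_def by (rule INF_lower) simp

context pair_bidirected_digraph
begin

abbreviation adj :: "'a \<Rightarrow> 'a \<Rightarrow> bool" (infix "\<sim>" 50) where
  "u \<sim> v \<equiv> (u, v) \<in> parcs G"

abbreviation closed_nbh :: "'a \<Rightarrow> 'a set" where
  "closed_nbh \<equiv> closed_neighbourhood G"

lemma adj_sym: "u \<sim> v \<Longrightarrow> v \<sim> u"
  using pair_sym_arcs by (auto simp: symmetric_def dest: symD)

lemma adj_irrefl: "\<not> u \<sim> u"
  using pair_no_loops[of "(u, u)"] by auto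

lemma in_neighbourhood: "v \<in> neighbourhood G u \<longleftrightarrow> u \<sim> v"
  by (simp add: neighbourhood_def)

lemma in_closed_nbh: "v \<in> closed_nbh u \<longleftrightarrow> v = u \<or> u \<sim> v"
  by (simp add: closed_neighbourhood_def in_neighbourhood)

lemma closed_nbh_sym: "v \<in> closed_nbh u \<longleftrightarrow> u \<in> closed_nbh v"
  using adj_sym by (auto simp: in_closed_nbh)

lemma in_closed_neighbourhood_set:
  "v \<in> closed_neighbourhood_set G U \<longleftrightarrow> (\<exists>u\<in>U. u \<in> closed_nbh v)"
  using closed_nbh_sym by (auto simp: closed_neighbourhood_set_def)

lemma closed_neighbourhood_set_subset:
  "U \<subseteq> pverts G \<Longrightarrow> closed_neighbourhood_set G U \<subseteq> pverts G"
  by (auto simp: closed_neighbourhood_set_def in_closed_nbh dest: in_arcsD2)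

lemma no_triangle:
  assumes "5 \<le> girth G" "a \<sim> b" "b \<sim> c" "c \<sim> a"
  shows False
proof -
  have "undirected_cycle G [(a,b),(b,c),(c,a)]"
    using assms adj_irrefl
    by (auto simp: undirected_cycle_def cycle_def awalk_def dest: in_arcsD1)
  from order_trans[OF assms(1) girth_le_length[OF this]] show False by (simp add: numeral_eq_enat)
qed

lemma no_square:
  assumes "5 \<le> girth G" "a \<sim> b" "b \<sim> c" "c \<sim> d" "d \<sim> a" "a \<noteq> c" "b \<noteq> d"
  shows False
proof -
  have "undirected_cycle G [(a,b),(b,c),(c,d),(d,a)]"
    using assms adj_irrefl
    by (auto simp: undirected_cycle_def cycle_def awalk_def dest: in_arcsD1)
  from order_trans[OF assms(1) girth_le_length[OF this]] show False by (simp add: numeral_eq_enat)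
qed

text \<open>
  A repeated vertex would split the closed walk into closed walks of lengths 2 and 3, so a
  graph without triangles has either no closed walk of length 5 or a pentagon.
\<close>

lemma no_pentagon:
  assumes g: "7 \<le> girth G" and walk: "a \<sim> b" "b \<sim> c" "c \<sim> d" "d \<sim> e" "e \<sim> a"
  shows False
proof -
  have g5: "5 \<le> girth G" using order_trans[OF _ g, of 5] by (simp add: numeral_eq_enat)
  have "distinct [a, b, c, d, e]"
    using walk adj_irrefl no_triangle[OF g5] adj_sym by (simp, metis)
  then have "undirected_cycle G [(a,b),(b,c),(c,d),(d,e),(e,a)]"
    using walk by (auto simp: undirected_cycle_def cycle_def awalk_def dest: in_arcsD1)
  from order_trans[OF g girth_le_length[OF this]] show False by (simp add: numeral_eq_enat)
qed

text \<open>
  Opposite vertices of the walk differ, since otherwise there would be a triangle. Vertices two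
  steps apart differ if the walk does not turn back between them; it is enough to exclude
  this at all corners but \<open>d\<close>, because turning back there would leave a square.
\<close>

lemma no_hexagon:
  assumes g: "7 \<le> girth G"
    and walk: "a \<sim> b" "b \<sim> c" "c \<sim> d" "d \<sim> e" "e \<sim> f" "f \<sim> a"
    and no_turn: "a \<noteq> c" "b \<noteq> d" "d \<noteq> f" "e \<noteq> a" "f \<noteq> b"
  shows False
proof -
  have g5: "5 \<le> girth G" using order_trans[OF _ g, of 5] by (simp add: numeral_eq_enat)
  have "c \<noteq> e" using no_square[OF g5, of a b c f] walk no_turn by auto
  moreover have "a \<noteq> d" "b \<noteq> e" "c \<noteq> f"
    using walk no_triangle[OF g5] by metis+
  ultimately have "undirected_cycle G [(a,b),(b,c),(c,d),(d,e),(e,f),(f,a)]"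
    using walk no_turn adj_irrefl
    by (auto simp: undirected_cycle_def cycle_def awalk_def dest: in_arcsD1)
  from order_trans[OF g girth_le_length[OF this]] show False by (simp add: numeral_eq_enat)
qed

section \<open>Covering the neighbours of a vertex\<close>

text \<open>
  The \<^emph>\<open>branch\<close> of a neighbour \<open>u\<close> of \<open>x\<close> is the closed neighbourhood of \<open>u\<close> without \<open>x\<close>.
  Distinct branches are disjoint, since a common element would close a triangle or a square.
\<close>

lemma branches_disjoint:
  assumes "5 \<le> girth G" "x \<sim> u" "x \<sim> v" "y \<in> closed_nbh u" "y \<in> closed_nbh v" "y \<noteq> x"
  shows "u = v"
proof (rule ccontr)
  assume "u \<noteq> v"
  with assms show False
    using no_triangle[of x u v] no_square[of x u y v] adj_sym by (auto simp: in_closed_nbh)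
qed

text \<open>
  Choosing for each neighbour of \<open>x\<close> an element of \<open>Y\<close> in its branch is injective; thus
  the neighbourhood of \<open>x\<close> is finite whenever \<open>Y\<close> is.
\<close>

lemma choice_of_covering_elements:
  assumes g: "5 \<le> girth G" and x: "x \<notin> Y" "closed_nbh x \<subseteq> closed_neighbourhood_set G Y"
  obtains f where "inj_on f (neighbourhood G x)" "f ` neighbourhood G x \<subseteq> Y"
    "\<forall>u\<in>neighbourhood G x. f u \<in> closed_nbh u"
proof -
  have "\<forall>u. \<exists>y. x \<sim> u \<longrightarrow> y \<in> Y \<and> y \<in> closed_nbh u"
    using x(2) by (metis in_closed_nbh in_closed_neighbourhood_set subsetD)
  then obtain f where f: "\<And>u. x \<sim> u \<Longrightarrow> f u \<in> Y \<and> f u \<in> closed_nbh u"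
    by metis
  have "inj_on f (neighbourhood G x)"
  proof (rule inj_onI)
    fix u v assume "u \<in> neighbourhood G x" "v \<in> neighbourhood G x" "f u = f v"
    with f[of u] f[of v] x(1) show "u = v"
      by (intro branches_disjoint[OF g, of x u v "f u"]) (auto simp: in_neighbourhood)
  qed
  with f show thesis by (intro that[of f]) (auto simp: in_neighbourhood)
qed

lemma card_neighbourhood_le:
  assumes "5 \<le> girth G" "x \<notin> Y" "closed_nbh x \<subseteq> closed_neighbourhood_set G Y" "finite Y"
  shows "finite (neighbourhood G x)" and "card (neighbourhood G x) \<le> card Y"
proof -
  obtain f where "inj_on f (neighbourhood G x)" "f ` neighbourhood G x \<subseteq> Y"
    by (rule choice_of_covering_elements[OF assms(1-3)])
  with \<open>finite Y\<close> show "finite (neighbourhood G x)" "card (neighbourhood G x) \<le> card Y"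
    by (meson inj_on_finite, meson card_inj_on_le)
qed

lemma min_degree_le_card:
  assumes "5 \<le> girth G" "x \<notin> Y" "closed_nbh x \<subseteq> closed_neighbourhood_set G Y" "finite Y"
    and "x \<in> pverts G" "min_degree G = enat \<delta>"
  shows "\<delta> \<le> card (neighbourhood G x)" "\<delta> \<le> card Y"
proof -
  have "enat \<delta> \<le> degree G x"
    using assms(5) unfolding assms(6)[symmetric] min_degree_def by (rule INF_lower)
  then show "\<delta> \<le> card (neighbourhood G x)"
    using card_neighbourhood_le[OF assms(1-4)] by (simp add: degree_def)
  then show "\<delta> \<le> card Y" using card_neighbourhood_le[OF assms(1-4)] by linarith
qed

definition perfectly_covers :: "'a set \<Rightarrow> 'a \<Rightarrow> bool" where
  "perfectly_covers Y x \<longleftrightarrow>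
     (\<forall>y\<in>Y. \<exists>u. x \<sim> u \<and> y \<in> closed_nbh u) \<and> (\<forall>u. x \<sim> u \<longrightarrow> (\<exists>!y. y \<in> Y \<and> y \<in> closed_nbh u))"

text \<open>
  The case of equality in \<open>card_neighbourhood_le\<close>: the injection is then onto \<open>Y\<close>, which means
  that \<open>Y\<close> is a transversal of the branches at \<open>x\<close>.
\<close>

lemma perfect_cover:
  assumes g: "5 \<le> girth G" and x: "x \<notin> Y" "closed_nbh x \<subseteq> closed_neighbourhood_set G Y"
    and Y: "finite Y" "card Y \<le> card (neighbourhood G x)"
  shows "perfectly_covers Y x"
proof -
  obtain f where f: "inj_on f (neighbourhood G x)" "f ` neighbourhood G x \<subseteq> Y"
    "\<forall>u\<in>neighbourhood G x. f u \<in> closed_nbh u"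
    using choice_of_covering_elements[OF g x] .
  have in_branch: "f u \<in> closed_nbh u" if "x \<sim> u" for u
    using f(3) that by (simp add: in_neighbourhood)
  have onto: "f ` neighbourhood G x = Y"
    using f Y by (intro card_seteq) (auto simp: card_image)
  have only: "y = f u" if "x \<sim> u" "y \<in> Y" "y \<in> closed_nbh u" for u y
  proof -
    obtain v where v: "x \<sim> v" "y = f v" using onto \<open>y \<in> Y\<close> by (auto simp: in_neighbourhood)
    moreover have "u = v"
      using that v in_branch[of v] x(1) by (intro branches_disjoint[OF g, of x u v y]) auto
    ultimately show ?thesis by simp
  qed
  have "\<exists>u. x \<sim> u \<and> y \<in> closed_nbh u" if "y \<in> Y" for y
    using that onto in_branch by (force simp: in_neighbourhood)
  moreover have "\<exists>!y. y \<in> Y \<and> y \<in> closed_nbh u" if "x \<sim> u" for u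
    using that f in_branch only[OF that] by (intro ex1I[of _ "f u"]) (auto simp: in_neighbourhood)
  ultimately show ?thesis unfolding perfectly_covers_def by blast
qed

lemma perfectly_covers_near:
  assumes "perfectly_covers Y x" "y \<in> Y"
  obtains u where "x \<sim> u" "y \<in> closed_nbh u"
  using assms unfolding perfectly_covers_def by blast

lemma perfectly_covers_unique:
  assumes "perfectly_covers Y x" "x \<sim> u" "y \<in> Y" "y \<in> closed_nbh u" "z \<in> Y" "z \<in> closed_nbh u"
  shows "y = z"
  using assms unfolding perfectly_covers_def by blast

section \<open>Mutually covering sets in girth at least seven\<close>

text \<open>
  If \<open>v\<close> were also in \<open>X\<close>, it would be within distance 2 of \<open>y\<close>, as \<open>x\<close> is. Joining the two
  short paths with the edge \<open>xv\<close> closes a cycle of length at most 5, unless \<open>y\<close> is adjacent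
  to \<open>x\<close> or \<open>v\<close>. In the former case \<open>x\<close> and \<open>v\<close> lie in one branch at \<open>y\<close>, in the latter \<open>v\<close>
  and \<open>y\<close> lie in one branch at \<open>x\<close>.
\<close>

lemma neighbour_not_in_both:
  assumes g: "7 \<le> girth G"
    and X: "perfectly_covers X y" and Y: "perfectly_covers Y x"
    and x: "x \<in> X" "x \<notin> Y" and y: "y \<in> Y" "y \<notin> X" and v: "x \<sim> v" "v \<in> Y"
  shows "v \<notin> X"
proof
  assume "v \<in> X"
  have g5: "5 \<le> girth G" using order_trans[OF _ g, of 5] by (simp add: numeral_eq_enat)
  have "v \<noteq> x" "v \<noteq> y" using v adj_irrefl \<open>v \<in> X\<close> y by auto
  obtain p where p: "y \<sim> p" "x \<in> closed_nbh p" using perfectly_covers_near[OF X x(1)] .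
  obtain q where q: "y \<sim> q" "v \<in> closed_nbh q" using perfectly_covers_near[OF X \<open>v \<in> X\<close>] .
  have "p \<noteq> q"
    using perfectly_covers_unique[OF X p(1) x(1) p(2) \<open>v \<in> X\<close>] q(2) \<open>v \<noteq> x\<close> by auto
  have "x \<noteq> p"
    using perfectly_covers_unique[OF X p(1) x(1) p(2) \<open>v \<in> X\<close>] v(1) \<open>v \<noteq> x\<close>
    by (auto simp: in_closed_nbh)
  moreover have "\<not> v \<sim> y"
    using perfectly_covers_unique[OF Y v(1) v(2) _ y(1)] \<open>v \<noteq> y\<close> by (auto simp: in_closed_nbh)
  ultimately show False
    using p q v \<open>p \<noteq> q\<close> no_pentagon[OF g, of x v q y p] adj_sym
    by (auto simp: in_closed_nbh)
qed

text \<open>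
  Here \<open>w\<close> is a neighbour of \<open>v\<close> other than \<open>x\<close>, and \<open>z\<close> an element of \<open>X\<close> that covers it.
  The two ways in which \<open>z\<close> can cover \<open>w\<close> lead to different contradictions: \<open>z = w\<close> would
  be within distance 2 of \<open>y\<close>, and \<open>z \<noteq> w\<close> would be outside \<open>Y\<close> and hence adjacent to some
  element of \<open>Y\<close>. Either way, a second path from \<open>x\<close>, avoiding \<open>v\<close>, closes a short cycle.
\<close>

lemma no_adjacent_pair:
  assumes g: "7 \<le> girth G"
    and eq: "closed_neighbourhood_set G X = closed_neighbourhood_set G Y"
    and covers: "\<And>z. z \<in> X - Y \<Longrightarrow> perfectly_covers Y z"
    and x: "x \<in> X" "x \<notin> Y" and v: "v \<in> Y" "v \<notin> X" and "x \<sim> v"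
    and w: "v \<sim> w" "w \<noteq> x" and y: "y \<in> Y" "y \<noteq> v"
  shows False
proof -
  have g5: "5 \<le> girth G" using order_trans[OF _ g, of 5] by (simp add: numeral_eq_enat)
  have Y: "perfectly_covers Y x" using covers x by simp
  have branch_v: "t = v" if "t \<in> Y" "t \<in> closed_nbh v" for t
    using perfectly_covers_unique[OF Y \<open>x \<sim> v\<close> that v(1)] by (simp add: in_closed_nbh)
  have "w \<notin> Y" using branch_v[of w] w(1) adj_irrefl by (auto simp: in_closed_nbh)
  have "w \<in> closed_neighbourhood_set G Y"
    using v(1) w(1) adj_sym by (auto simp: in_closed_neighbourhood_set in_closed_nbh)
  then obtain z where z: "z \<in> X" "z \<in> closed_nbh w"
    unfolding eq[symmetric] in_closed_neighbourhood_set by blast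
  show False
  proof (cases "z = w")
    case True
    then have "perfectly_covers Y w" using covers z(1) \<open>w \<notin> Y\<close> by simp
    then obtain b where b: "w \<sim> b" "y \<in> closed_nbh b" using perfectly_covers_near y(1) by blast
    obtain u where u: "x \<sim> u" "y \<in> closed_nbh u" using perfectly_covers_near[OF Y y(1)] .
    have "u \<noteq> v" "b \<noteq> v" using branch_v[OF y(1)] y(2) u(2) b(2) by auto
    have "y \<noteq> x" using y(1) x(2) by auto
    have "u \<noteq> b"
      using no_square[OF g5 \<open>x \<sim> v\<close> w(1), of u] u(1) b(1) adj_sym w(2) \<open>u \<noteq> v\<close> by blast
    consider "y = u" | "y = b" | "u \<sim> y" "b \<sim> y" using u(2) b(2) by (auto simp: in_closed_nbh)
    then show False
    proof cases
      case 1
      then have "b \<sim> u" using b(2) \<open>u \<noteq> b\<close> by (auto simp: in_closed_nbh)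
      then show False using no_pentagon[OF g \<open>x \<sim> v\<close> w(1) b(1)] u(1) adj_sym by blast
    next
      case 2
      then have "b \<sim> u" using u(2) \<open>u \<noteq> b\<close> adj_sym by (auto simp: in_closed_nbh)
      then show False using no_pentagon[OF g \<open>x \<sim> v\<close> w(1) b(1)] u(1) adj_sym by blast
    next
      case 3
      then show False
        using no_hexagon[OF g \<open>x \<sim> v\<close> w(1) b(1), of y u] u(1) adj_sym w(2)
          \<open>u \<noteq> v\<close> \<open>b \<noteq> v\<close> \<open>u \<noteq> b\<close> \<open>y \<noteq> x\<close> by metis
    qed
  next
    case False
    then have "w \<sim> z" using z(2) by (auto simp: in_closed_nbh)
    have "z \<noteq> v" using z(1) v(2) by auto
    have "\<not> x \<sim> z"
      using no_square[OF g5 \<open>x \<sim> v\<close> w(1) \<open>w \<sim> z\<close>] adj_sym w(2) \<open>z \<noteq> v\<close> by blast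
    have "z \<notin> Y"
    proof
      assume "z \<in> Y"
      then obtain u where "x \<sim> u" "z \<in> closed_nbh u" using perfectly_covers_near[OF Y] by blast
      then have "u \<sim> z" using \<open>\<not> x \<sim> z\<close> by (auto simp: in_closed_nbh)
      then show False
        using no_pentagon[OF g \<open>x \<sim> v\<close> w(1) \<open>w \<sim> z\<close>] \<open>x \<sim> u\<close> adj_sym by blast
    qed
    have "z \<in> closed_neighbourhood_set G Y"
      unfolding eq[symmetric] using z(1) by (auto simp: in_closed_neighbourhood_set in_closed_nbh)
    then obtain t where t: "t \<in> Y" "z \<sim> t"
      using \<open>z \<notin> Y\<close> by (auto simp: in_closed_neighbourhood_set in_closed_nbh)
    have "t \<noteq> v" using no_triangle[OF g5 w(1) \<open>w \<sim> z\<close>] t(2) by auto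
    obtain u where u: "x \<sim> u" "t \<in> closed_nbh u" using perfectly_covers_near[OF Y t(1)] .
    have "u \<noteq> v" using branch_v[OF t(1)] \<open>t \<noteq> v\<close> u(2) by auto
    have "t \<noteq> x" using t(1) x(2) by auto
    have "\<not> x \<sim> t" using no_pentagon[OF g \<open>x \<sim> v\<close> w(1) \<open>w \<sim> z\<close> t(2)] adj_sym by blast
    then have "u \<sim> t" using u by (auto simp: in_closed_nbh)
    then show False
      using no_hexagon[OF g \<open>x \<sim> v\<close> w(1) \<open>w \<sim> z\<close> t(2), of u] u(1) adj_sym w(2)
        \<open>z \<noteq> v\<close> \<open>\<not> x \<sim> z\<close> \<open>t \<noteq> x\<close> \<open>u \<noteq> v\<close> by metis
  qed
qed

section \<open>Identifying codes\<close>

text \<open>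
  Enlarging a code only helps it to separate sets, so all vertices are taken; and by
  symmetry it is enough to consider a vertex that is in the first set only.
\<close>

lemma admits_identifying_codeI:
  assumes "\<And>X Y x. \<lbrakk>X \<subseteq> pverts G; Y \<subseteq> pverts G; finite X; finite Y; card X \<le> l; card Y \<le> l;
      closed_neighbourhood_set G X = closed_neighbourhood_set G Y; x \<in> X; x \<notin> Y\<rbrakk> \<Longrightarrow> False"
  shows "admits_identifying_code G l"
proof -
  have "closed_neighbourhood_set G X \<inter> pverts G \<noteq> closed_neighbourhood_set G Y \<inter> pverts G"
    if XY: "X \<subseteq> pverts G" "Y \<subseteq> pverts G" "X \<noteq> Y"
      "1 \<le> card X" "card X \<le> l" "1 \<le> card Y" "card Y \<le> l" for X Y
  proof
    assume "closed_neighbourhood_set G X \<inter> pverts G = closed_neighbourhood_set G Y \<inter> pverts G"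
    then have eq: "closed_neighbourhood_set G X = closed_neighbourhood_set G Y"
      using XY closed_neighbourhood_set_subset by blast
    have fin: "finite X" "finite Y"
      using XY by (auto intro: card_ge_0_finite)
    from \<open>X \<noteq> Y\<close> consider x where "x \<in> X" "x \<notin> Y" | x where "x \<in> Y" "x \<notin> X" by blast
    then show False using assms[of X Y] assms[of Y X] XY eq fin by cases auto
  qed
  then show ?thesis
    unfolding admits_identifying_code_def identifying_code_def by (intro exI[of _ "pverts G"]) blast
qed

lemma closed_nbh_subset_of_eq:
  assumes "closed_neighbourhood_set G X = closed_neighbourhood_set G Y" "x \<in> X"
  shows "closed_nbh x \<subseteq> closed_neighbourhood_set G Y"
  using assms unfolding closed_neighbourhood_set_def by blast

theorem admits_identifying_code_girth_5:
  assumes g: "5 \<le> girth G" and \<delta>: "min_degree G = enat \<delta>" "l < \<delta>"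
  shows "admits_identifying_code G l"
proof (rule admits_identifying_codeI)
  fix X Y x
  assume "X \<subseteq> pverts G" "finite Y" "card Y \<le> l" "x \<in> X" "x \<notin> Y"
    and eq: "closed_neighbourhood_set G X = closed_neighbourhood_set G Y"
  then have "\<delta> \<le> card Y"
    by (intro min_degree_le_card(2)[OF g _ closed_nbh_subset_of_eq[OF eq]] \<delta>(1)) auto
  with \<open>card Y \<le> l\<close> \<open>l < \<delta>\<close> show False by simp
qed

theorem admits_identifying_code_girth_7:
  assumes g: "7 \<le> girth G" and \<delta>: "min_degree G = enat \<delta>" "2 \<le> \<delta>"
  shows "admits_identifying_code G \<delta>"
proof (rule admits_identifying_codeI)
  fix X Y x
  assume XY: "X \<subseteq> pverts G" "Y \<subseteq> pverts G" "finite X" "finite Y" "card X \<le> \<delta>" "card Y \<le> \<delta>"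
    and eq: "closed_neighbourhood_set G X = closed_neighbourhood_set G Y"
    and x: "x \<in> X" "x \<notin> Y"
  have g5: "5 \<le> girth G" using order_trans[OF _ g, of 5] by (simp add: numeral_eq_enat)
  have deg: "\<delta> \<le> card (neighbourhood G z)" "\<delta> \<le> card Y"
    and Y: "perfectly_covers Y z" if "z \<in> X - Y" for z
  proof -
    note sub = closed_nbh_subset_of_eq[OF eq, of z]
    show "\<delta> \<le> card (neighbourhood G z)" "\<delta> \<le> card Y"
      using min_degree_le_card[OF g5 _ sub] that XY \<delta>(1) by auto
    then show "perfectly_covers Y z"
      using that XY by (intro perfect_cover[OF g5 _ sub]) auto
  qed
  have X: "\<delta> \<le> card (neighbourhood G z)" "perfectly_covers X z" if "z \<in> Y - X" for z
  proof -
    note sub = closed_nbh_subset_of_eq[OF eq[symmetric], of z]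
    show "\<delta> \<le> card (neighbourhood G z)"
      using min_degree_le_card(1)[OF g5 _ sub] that XY \<delta>(1) by auto
    then show "perfectly_covers X z"
      using that XY by (intro perfect_cover[OF g5 _ sub]) auto
  qed
  have "\<delta> \<le> card Y" using deg(2) x by blast
  have "\<not> Y \<subseteq> X"
  proof
    assume "Y \<subseteq> X"
    then have "card Y < card X" using x XY(3) by (intro psubset_card_mono) auto
    with \<open>\<delta> \<le> card Y\<close> XY(5) show False by simp
  qed
  then obtain y where y: "y \<in> Y" "y \<notin> X" by blast
  have "x \<in> closed_neighbourhood_set G Y"
    using closed_nbh_subset_of_eq[OF eq x(1)] by (auto simp: in_closed_nbh)
  then obtain v where v: "v \<in> Y" "x \<sim> v"
    using x(2) by (auto simp: in_closed_neighbourhood_set in_closed_nbh)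
  have "v \<notin> X"
    using neighbour_not_in_both[OF g X(2) Y x y v(2,1)] x y by simp
  have "\<not> neighbourhood G v \<subseteq> {x}"
    using X(1)[of v] v(1) \<open>v \<notin> X\<close> \<delta>(2) card_mono[of "{x}" "neighbourhood G v"] by auto
  then obtain w where "v \<sim> w" "w \<noteq> x" by (metis in_neighbourhood singletonI subsetI)
  moreover have "\<not> Y \<subseteq> {v}"
    using \<open>\<delta> \<le> card Y\<close> \<delta>(2) card_mono[of "{v}" Y] by auto
  then obtain t where "t \<in> Y" "t \<noteq> v" by blast
  ultimately show False
    using no_adjacent_pair[OF g eq Y x v(1) \<open>v \<notin> X\<close> v(2)] by blast
qed

end

theorem corollary3:
  fixes G :: "'a pair_pre_digraph" and g :: enat and \<delta> :: nat
  assumes "pair_bidirected_digraph G"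
    and "girth G = g"
    and "min_degree G = enat \<delta>"
    and "\<delta> \<ge> 2"
  shows "(g \<ge> 7 \<longrightarrow> admits_identifying_code G \<delta>) \<and>
         (g \<ge> 5 \<longrightarrow> admits_identifying_code G (\<delta> - 1))"
proof -
  interpret pair_bidirected_digraph G by fact
  show ?thesis
    using admits_identifying_code_girth_7[OF _ assms(3,4)]
      admits_identifying_code_girth_5[OF _ assms(3), of "\<delta> - 1"] assms(2,4) by auto
qed

end
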